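(* Let $p$ be an odd prime with $p \equiv 2 \pmod 3$, and let $c \in \{1, -1\}$. For a positive integer $n$, let $M_n = [m_{ij}]_{1 \le i,j \le n}$ be the $n \times n$ matrix with entries $m_{ij} = \left[ \frac{j-i+c}{p} \right]$. Then for every $n$ with $1 < n \le p-1$, $\det(M_n) = 1$.
   Context: For an odd prime $p$ and an integer $a$, the cubic residue symbol is defined by $\left[ \frac{a}{p} \right] = 1$ if $a \not\equiv 0 \pmod p$ and $x^3 \equiv a \pmod p$ has an integer solution; $\left[ \frac{a}{p} \right] = -1$ if $x^3 \equiv a \pmod p$ has no integer solution; and $\left[ \frac{a}{p} \right] = 0$ if $a \equiv 0 \pmod p$. *)

theory Defs
  imports
    "HOL-Number_Theory.Cong"
    "HOL-Computational_Algebra.Primes"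
    "Jordan_Normal_Form.Determinant"
begin

definition cubic_residue_symbol :: "int \<Rightarrow> nat \<Rightarrow> int" where
  "cubic_residue_symbol a p =
     (if [a = 0] (mod int p) then 0
      else if \<exists>x::int. [x ^ 3 = a] (mod int p) then 1
      else -1)"

(* Indices of the type mat start at 0, so the entry at (i, j) below is the entry
   m_{i+1, j+1} of the matrix whose rows and columns are numbered from 1 to n. *)
definition cubic_residue_matrix :: "nat \<Rightarrow> int \<Rightarrow> nat \<Rightarrow> int mat" where
  "cubic_residue_matrix p c n =
     mat n n (\<lambda>(i, j). cubic_residue_symbol (int (Suc j) - int (Suc i) + c) p)"

end

theory Submission
  imports Defs "HOL-Number_Theory.Residues"
begin

text \<open>
  If \<open>p = 3 * m + 2\<close>, then \<open>3 * (2 * m + 1) = 2 * (p - 1) + 1\<close>, so by Fermat every residue \<open>a\<close> is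
  the cube of \<open>a ^ (2 * m + 1)\<close> and the symbol is \<open>1\<close> away from \<open>0\<close>. For \<open>n < p\<close> the matrix is thus,
  up to transposition, the all-ones matrix with zeros on the subdiagonal, and subtracting from
  each row the next one makes it lower unitriangular.
\<close>

lemma cube_root_mod_prime:
  fixes a :: int
  assumes "prime p" and "[p = 2] (mod 3)" and "\<not> [a = 0] (mod int p)"
  shows "\<exists>x. [x ^ 3 = a] (mod int p)"
proof -
  define m where "m = p div 3"
  have p: "p = 3 * m + 2"
    using assms(2) mult_div_mod_eq[of 3 p] by (simp add: cong_def m_def)
  have "p > 0" using assms(1) by (rule prime_gt_0_nat)
  \<comment> \<open>Fermat's theorem is applied over the naturals, so \<open>a\<close> is replaced
    by its least nonnegative residue.\<close>
  define b where "b = nat (a mod int p)"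
  have b: "int b = a mod int p"
    using \<open>p > 0\<close> by (simp add: b_def)
  have "b < p" "b \<noteq> 0"
    using \<open>p > 0\<close> assms(3) pos_mod_bound[of "int p" a] b
    by (simp_all add: cong_def del: pos_mod_bound)
  then have "\<not> p dvd b" by (auto dest: dvd_imp_le)
  then have "[b ^ (p - 1) = 1] (mod p)"
    using assms(1) by (intro fermat_theorem)
  then have "[(b ^ (p - 1)) ^ 2 * b = 1 ^ 2 * b] (mod p)"
    by (intro cong_mult cong_pow cong_refl)
  moreover have "(b ^ (p - 1)) ^ 2 * b = (b ^ (2 * m + 1)) ^ 3"
  proof -
    have "(p - 1) * 2 + 1 = (2 * m + 1) * 3" using p by simp
    then show ?thesis by (metis power_add power_mult power_one_right)
  qed
  ultimately have "[(int b ^ (2 * m + 1)) ^ 3 = int b] (mod int p)"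
    by (metis cong_int_iff mult_1 of_nat_power power_one)
  then show ?thesis
    unfolding b by (metis cong_mod_right)
qed

lemma cubic_residue_symbol_eq:
  assumes "prime p" and "[p = 2] (mod 3)"
  shows "cubic_residue_symbol a p = (if int p dvd a then 0 else 1)"
  using cube_root_mod_prime[OF assms] by (auto simp: cubic_residue_symbol_def cong_0_iff)

lemma det_ones_zero_subdiagonal:
  assumes "n > 0"
  shows "det (mat n n (\<lambda>(i, j). if i = Suc j then 0 else 1 :: 'a :: comm_ring_1)) = 1"
    (is "det ?M = 1")
proof -
  \<comment> \<open>Left multiplication by \<open>U\<close> subtracts from each row the next one and
    keeps the last row.\<close>
  define U :: "'a mat" where
    "U = mat n n (\<lambda>(i, j). if i = j then 1 else if j = Suc i then -1 else 0)"
  have U: "U \<in> carrier_mat n n" and M: "?M \<in> carrier_mat n n" by (simp_all add: U_def)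
  have UM: "(U * ?M) $$ (i, j) = (if Suc i < n then of_bool (i = j) - of_bool (i = Suc j)
      else of_bool (i \<noteq> Suc j))" if "i < n" "j < n" for i j
  proof -
    \<comment> \<open>Only \<open>k = i\<close> and \<open>k = Suc i\<close> contribute; in the last
      row \<open>Suc i\<close> falls outside the range of summation.\<close>
    have "(U * ?M) $$ (i, j) = (\<Sum>k<n. (if k = i then ?M $$ (k, j) else 0) -
        (if k = Suc i then ?M $$ (k, j) else 0))"
      using that by (simp add: U_def scalar_prod_def lessThan_atLeast0)
        (rule sum.cong, auto)
    also have "\<dots> = ?M $$ (i, j) - (if Suc i < n then ?M $$ (Suc i, j) else 0)"
      using that by (simp add: sum_subtractf sum.delta)
    finally show ?thesis using that by auto
  qed
  \<comment> \<open>An entry above the diagonal lies in a row with \<open>Suc i < n\<close>, where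
    both indicators vanish. The unchanged last row also has 1 on the diagonal, since
    \<open>i\<close> differs from \<open>Suc i\<close>.\<close>
  have "det (U * ?M) = prod_list (diag_mat (U * ?M))"
    by (rule det_lower_triangular[OF _ mult_carrier_mat[OF U M]]) (auto simp: UM)
  also have "\<dots> = 1"
    using U by (auto simp: prod_list_diag_prod UM simp del: index_mult_mat(1) intro!: prod.neutral)
  finally have "det U * det ?M = 1" by (simp add: det_mult[OF U M])
  moreover have "det U = 1"
    by (subst det_upper_triangular[OF _ U])
      (auto simp: U_def prod_list_diag_prod upper_triangular_def)
  ultimately show ?thesis by simp
qed

theorem theorem3p3:
  fixes p n :: nat and c :: int
  assumes "prime p" and "odd p" and "[p = 2] (mod 3)"
    and "c \<in> {1, -1}"
    and "1 < n" and "n \<le> p - 1"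
  shows "det (cubic_residue_matrix p c n) = 1"
proof -
  let ?M = "mat n n (\<lambda>(i, j). if i = Suc j then 0 else 1 :: int)"
  have dvd_iff: "int p dvd int (Suc j) - int (Suc i) + c \<longleftrightarrow> int i = int j + c"
    if "i < n" "j < n" for i j
  proof
    assume "int p dvd int (Suc j) - int (Suc i) + c"
    \<comment> \<open>Indices differ by at most \<open>n - 1\<close> and \<open>c\<close> adds at
      most 1, so the bound is \<open>n\<close>, which is below \<open>p\<close>; the only such
      multiple of \<open>p\<close> is 0.\<close>
    moreover have "\<bar>int (Suc j) - int (Suc i) + c\<bar> < int p"
      using that assms(4-6) by auto
    ultimately have "int (Suc j) - int (Suc i) + c = 0"
      using dvd_imp_le_int[of "int (Suc j) - int (Suc i) + c" "int p"] by linarith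
    then show "int i = int j + c" by simp
  qed simp
  have "cubic_residue_matrix p c n = mat n n (\<lambda>(i, j). if int i = int j + c then 0 else 1)"
    unfolding cubic_residue_matrix_def
    by (rule cong_mat) (simp_all only: prod.case cubic_residue_symbol_eq[OF assms(1,3)] dvd_iff)
  \<comment> \<open>For \<open>c = -1\<close> the zeros lie on the superdiagonal.\<close>
  also have "\<dots> = (if c = 1 then ?M else transpose_mat ?M)"
    using assms(4) by (intro eq_matI) auto
  finally have "cubic_residue_matrix p c n = (if c = 1 then ?M else transpose_mat ?M)" .
  moreover have "det (transpose_mat ?M) = det ?M"
    by (rule det_transpose[of _ n]) simp
  moreover have "det ?M = 1"
    using assms(5) by (intro det_ones_zero_subdiagonal) simp
  ultimately show ?thesis by simp
qed

end
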